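(* For any natural numbers $n$ and $k$ there exist $n$ elements $a_1,\dots,a_n$ in Thompson's group $F$ such that no relation in $n$ variables of length less than $k$ is satisfied by $a_1,\dots,a_n$; that is, $w(a_1,\dots,a_n)\neq 1$ in $F$ for every non-trivial reduced word $w(x_1,\dots,x_n)$ of length less than $k$.
   Context: Thompson's group $F$ is the group (under composition) of all piecewise linear orientation-preserving homeomorphisms of the unit interval $[0,1]$ with finitely many breakpoints such that all slopes are powers of $2$ (integer exponents) and all breakpoints lie in $\mathbb{Z}[\frac12]$, the ring of dyadic rational numbers. A relation in $n$ variables is a non-trivial reduced word $w(x_1,\dots,x_n)$ in the letters $x_1^{\pm1},\dots,x_n^{\pm1}$, i.e. a non-trivial element of the free group on $x_1,\dots,x_n$; its length is the number of letters of the reduced word. Elements $a_1,\dots,a_n$ of a group satisfy the relation $w$ if $w(a_1,\dots,a_n)=1$, where $w(a_1,\dots,a_n)$ is obtained by substituting $a_i$ for $x_i$. *)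

theory Defs
  imports "HOL-Analysis.Analysis" "HOL-Algebra.Bij"
begin

definition dyadic :: "real set" where
  "dyadic = {of_int m / 2 ^ j | (m :: int) (j :: nat). True}"

text \<open>
  The set \<open>B\<close> may be any finite set of dyadic numbers containing the interior breakpoints of
  \<open>f\<close>; on every subinterval whose interior avoids \<open>B\<close>, the map is affine with slope a power of 2.
\<close>
definition dyadic_PL :: "(real \<Rightarrow> real) \<Rightarrow> bool" where
  "dyadic_PL f \<longleftrightarrow>
     (\<exists>B. finite B \<and> B \<subseteq> dyadic \<and>
        (\<forall>a b. 0 \<le> a \<and> a < b \<and> b \<le> 1 \<and> B \<inter> {a<..<b} = {} \<longrightarrow>
           (\<exists>(k :: int) c. \<forall>x\<in>{a..b}. f x = 2 powi k * x + c)))"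

text \<open>Maps of the unit interval are represented by their extensional representatives.\<close>
definition thompson_maps :: "(real \<Rightarrow> real) set" where
  "thompson_maps =
     {f \<in> extensional {0..1}. (\<exists>g. homeomorphism {0..1} {0..1} f g) \<and>
        strict_mono_on {0..1} f \<and> dyadic_PL f}"

definition thompson_F :: "(real \<Rightarrow> real) monoid" where
  "thompson_F = (BijGroup {0..1})\<lparr>carrier := thompson_maps\<rparr>"

text \<open>The pair \<open>(i, True)\<close> stands for \<open>x\<^sub>i\<close> and \<open>(i, False)\<close> for its inverse.\<close>
type_synonym letter = "nat \<times> bool"

definition reduced_word :: "letter list \<Rightarrow> bool" where
  "reduced_word w \<longleftrightarrow> successively (\<lambda>(i, s) (j, t). \<not> (i = j \<and> s \<noteq> t)) w"

definition relation_in :: "nat \<Rightarrow> letter list \<Rightarrow> bool" where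
  "relation_in n w \<longleftrightarrow> w \<noteq> [] \<and> reduced_word w \<and> fst ` set w \<subseteq> {1..n}"

definition letter_value :: "('a, 'b) monoid_scheme \<Rightarrow> (nat \<Rightarrow> 'a) \<Rightarrow> letter \<Rightarrow> 'a" where
  "letter_value G a l = (if snd l then a (fst l) else inv\<^bsub>G\<^esub> (a (fst l)))"

definition word_value :: "('a, 'b) monoid_scheme \<Rightarrow> (nat \<Rightarrow> 'a) \<Rightarrow> letter list \<Rightarrow> 'a" where
  "word_value G a w = foldr (\<lambda>l g. letter_value G a l \<otimes>\<^bsub>G\<^esub> g) w \<one>\<^bsub>G\<^esub>"

definition satisfies :: "('a, 'b) monoid_scheme \<Rightarrow> (nat \<Rightarrow> 'a) \<Rightarrow> letter list \<Rightarrow> bool" where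
  "satisfies G a w \<longleftrightarrow> word_value G a w = \<one>\<^bsub>G\<^esub>"


lemma dyadic_0: "0 \<in> dyadic"
  unfolding dyadic_def by (auto intro!: exI[of _ 0])

lemma dyadic_add:
  assumes "x \<in> dyadic" "y \<in> dyadic"
  shows "x + y \<in> dyadic"
proof -
  obtain m i n j where "x = of_int m / 2 ^ i" "y = of_int n / 2 ^ j"
    using assms unfolding dyadic_def by blast
  then have "x + y = of_int (m * 2 ^ j + n * 2 ^ i) / 2 ^ (i + j)"
    by (simp add: add_divide_distrib power_add)
  then show ?thesis
    unfolding dyadic_def by blast
qed

lemma dyadic_uminus: "x \<in> dyadic \<Longrightarrow> - x \<in> dyadic"
  unfolding dyadic_def by clarsimp (metis minus_divide_left of_int_minus)

lemma dyadic_diff: "x \<in> dyadic \<Longrightarrow> y \<in> dyadic \<Longrightarrow> x - y \<in> dyadic"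
  using dyadic_add[of x "- y"] dyadic_uminus[of y] by simp

lemma dyadic_scale:
  assumes "x \<in> dyadic"
  shows "2 powi k * x \<in> dyadic"
proof -
  obtain m i where x: "x = of_int m / 2 ^ i"
    using assms unfolding dyadic_def by blast
  show ?thesis
  proof (cases "k \<ge> 0")
    case True
    then have "2 powi k * x = of_int (2 ^ nat k * m) / 2 ^ i"
      by (simp add: x power_int_def)
    then show ?thesis
      unfolding dyadic_def by blast
  next
    case False
    then have "2 powi k * x = of_int m / 2 ^ (nat (- k) + i)"
      by (simp add: x power_int_def field_simps power_add)
    then show ?thesis
      unfolding dyadic_def by blast
  qed
qed

lemma dyadic_scale_iff: "2 powi k * x \<in> dyadic \<longleftrightarrow> x \<in> dyadic"
proof
  assume "2 powi k * x \<in> dyadic"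
  then have "2 powi (- k) * (2 powi k * x) \<in> dyadic"
    by (rule dyadic_scale)
  then show "x \<in> dyadic"
    by (simp add: power_int_minus flip: mult.assoc)
qed (rule dyadic_scale)

lemma thompson_maps_subset_Bij: "thompson_maps \<subseteq> Bij {0..1}"
proof
  fix f assume "f \<in> thompson_maps"
  then obtain g where "homeomorphism {0..1} {0..1} f g" and ext: "f \<in> extensional {0..1}"
    unfolding thompson_maps_def by blast
  then have "bij_betw f {0..1} {0..1}"
    by (auto simp: homeomorphism_def intro!: bij_betw_byWitness[where f' = g])
  with ext show "f \<in> Bij {0..1}"
    by (simp add: Bij_def)
qed

lemma thompson_maps_0:
  assumes "f \<in> thompson_maps"
  shows "f 0 = 0"
proof -
  have bij: "f ` {0..1} = {0..1}" and sm: "strict_mono_on {0..1} f"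
    using assms thompson_maps_subset_Bij
    by (auto simp: thompson_maps_def Bij_def bij_betw_def)
  have "0 \<in> f ` {0..1}"
    by (simp add: bij)
  then obtain x where x: "x \<in> {0..1}" "f x = 0"
    by auto
  have "f 0 \<in> f ` {0..1}"
    by (rule imageI) simp
  then have "f 0 \<ge> 0"
    by (simp add: bij)
  moreover have "x > 0 \<Longrightarrow> f 0 < f x"
    using x(1) by (intro strict_mono_onD[OF sm]) auto
  ultimately show ?thesis
    using x by (cases "x = 0") auto
qed

lemma thompson_maps_affineE:
  assumes "f \<in> thompson_maps"
  obtains B where "finite B" "B \<subseteq> dyadic"
    "\<forall>a b. 0 \<le> a \<and> a < b \<and> b \<le> 1 \<and> B \<inter> {a<..<b} = {} \<longrightarrow>
      (\<exists>(k :: int) c. \<forall>x\<in>{a..b}. f x = 2 powi k * x + c)"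
proof -
  have "dyadic_PL f"
    using assms by (simp add: thompson_maps_def)
  then obtain B where "finite B \<and> B \<subseteq> dyadic \<and>
        (\<forall>a b. 0 \<le> a \<and> a < b \<and> b \<le> 1 \<and> B \<inter> {a<..<b} = {} \<longrightarrow>
           (\<exists>(k :: int) c. \<forall>x\<in>{a..b}. f x = 2 powi k * x + c))"
    unfolding dyadic_PL_def by (rule exE)
  then show ?thesis
    by (elim conjE) (rule that)
qed

lemma thompson_maps_dyadic_iff:
  assumes f: "f \<in> thompson_maps" and x: "x \<in> {0..1}"
  shows "f x \<in> dyadic \<longleftrightarrow> x \<in> dyadic"
proof -
  obtain B where B: "finite B" "B \<subseteq> dyadic"
    and aff_all: "\<forall>a b. 0 \<le> a \<and> a < b \<and> b \<le> 1 \<and> B \<inter> {a<..<b} = {} \<longrightarrow>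
      (\<exists>(k :: int) c. \<forall>x\<in>{a..b}. f x = 2 powi k * x + c)"
    using f by (rule thompson_maps_affineE)
  note aff = aff_all[rule_format, OF conjI[OF _ conjI[OF _ conjI]]]
  have step: "f b \<in> dyadic \<longleftrightarrow> b \<in> dyadic"
    if ab: "0 \<le> a" "a < b" "b \<le> 1" "B \<inter> {a<..<b} = {}" and a: "a \<in> dyadic" "f a \<in> dyadic" for a b
  proof -
    obtain k :: int and c where "\<forall>x\<in>{a..b}. f x = 2 powi k * x + c"
      using aff[OF ab] by blast
    then have eq: "f b = f a + 2 powi k * (b - a)"
      using ab(2) by (simp add: algebra_simps)
    have "f b \<in> dyadic \<longleftrightarrow> 2 powi k * (b - a) \<in> dyadic"
      using dyadic_add[OF a(2), of "2 powi k * (b - a)"] dyadic_diff[OF _ a(2), of "f b"]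
      by (auto simp: eq)
    also have "\<dots> \<longleftrightarrow> b - a \<in> dyadic"
      by (rule dyadic_scale_iff)
    also have "\<dots> \<longleftrightarrow> b \<in> dyadic"
      using dyadic_add[OF a(1), of "b - a"] dyadic_diff[OF _ a(1), of b] by auto
    finally show ?thesis .
  qed
  show ?thesis
    using x
  proof (induction "card (B \<inter> {0<..<x})" arbitrary: x rule: less_induct)
    case less
    show ?case
    proof (cases "x = 0")
      case True
      then show ?thesis
        by (simp add: thompson_maps_0[OF f])
    next
      case False
      define C where "C = B \<inter> {0<..<x}"
      have fin: "finite C"
        by (simp add: C_def B)
      show ?thesis
      proof (cases "C = {}")
        case True
        then show ?thesis
          using step[of 0 x] less.prems False
          by (auto simp: C_def dyadic_0 thompson_maps_0[OF f])
      next
        case ne: False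
        define b where "b = Max C"
        have b: "b \<in> C"
          unfolding b_def by (rule Max_in[OF fin ne])
        have "B \<inter> {0<..<b} \<subset> C"
          using b by (auto simp: C_def)
        then have "card (B \<inter> {0<..<b}) < card C"
          by (rule psubset_card_mono[OF fin])
        then have "f b \<in> dyadic \<longleftrightarrow> b \<in> dyadic"
          using b less.prems by (intro less.hyps) (auto simp: C_def)
        moreover have "b \<in> dyadic"
          using b B by (auto simp: C_def)
        moreover have "B \<inter> {b<..<x} = {}"
        proof (rule ccontr)
          assume "B \<inter> {b<..<x} \<noteq> {}"
          then obtain y where y: "y \<in> B" "b < y" "y < x"
            by auto
          then have "y \<in> C"
            using b by (auto simp: C_def)
          then have "y \<le> b"
            unfolding b_def using fin by simp
          with y show False
            by simp
        qed
        ultimately show ?thesis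
          using step[of b x] b less.prems by (auto simp: C_def)
      qed
    qed
  qed
qed

lemma thompson_maps_id: "(\<lambda>x\<in>{0..1}. x) \<in> thompson_maps"
proof -
  have "dyadic_PL (\<lambda>x\<in>{0..1}. x)"
    unfolding dyadic_PL_def
    by (rule exI[of _ "{}"]) (auto intro!: exI[of _ "0 :: int"] exI[of _ "0 :: real"])
  moreover have "homeomorphism {0..1 :: real} {0..1} (\<lambda>x\<in>{0..1}. x) (\<lambda>x. x)"
    by (rule homeomorphism_cong[OF homeomorphism_ident]) auto
  ultimately show ?thesis
    unfolding thompson_maps_def by (auto simp: strict_mono_on_def)
qed

lemma thompson_maps_compose:
  assumes f: "f \<in> thompson_maps" and g: "g \<in> thompson_maps"
  shows "compose {0..1} g f \<in> thompson_maps"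
proof -
  obtain f' g' where hf: "homeomorphism {0..1} {0..1} f f'" and hg: "homeomorphism {0..1} {0..1} g g'"
    using f g unfolding thompson_maps_def by blast
  have mf: "strict_mono_on {0..1} f" and mg: "strict_mono_on {0..1} g"
    using f g unfolding thompson_maps_def by auto
  have imf: "f ` {0..1} = {0..1}" and inj: "inj_on f {0..1}"
    using f thompson_maps_subset_Bij by (auto simp: Bij_def bij_betw_def)
  have mem: "f x \<in> {0..1}" if "x \<in> {0..1}" for x
    using imf that by blast
  obtain B where B: "finite B" "B \<subseteq> dyadic"
    and affB_all: "\<forall>a b. 0 \<le> a \<and> a < b \<and> b \<le> 1 \<and> B \<inter> {a<..<b} = {} \<longrightarrow>
      (\<exists>(k :: int) c. \<forall>x\<in>{a..b}. f x = 2 powi k * x + c)"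
    using f by (rule thompson_maps_affineE)
  note affB = affB_all[rule_format, OF conjI[OF _ conjI[OF _ conjI]]]
  obtain C where C: "finite C" "C \<subseteq> dyadic"
    and affC_all: "\<forall>a b. 0 \<le> a \<and> a < b \<and> b \<le> 1 \<and> C \<inter> {a<..<b} = {} \<longrightarrow>
      (\<exists>(k :: int) c. \<forall>x\<in>{a..b}. g x = 2 powi k * x + c)"
    using g by (rule thompson_maps_affineE)
  note affC = affC_all[rule_format, OF conjI[OF _ conjI[OF _ conjI]]]
  define D where "D = B \<union> (f -` C \<inter> {0..1})"
  have "finite D"
    using B C inj by (simp add: D_def finite_vimage_IntI)
  have "D \<subseteq> dyadic"
    using B C thompson_maps_dyadic_iff[OF f] by (auto simp: D_def)
  have affine: "\<exists>(k :: int) c. \<forall>x\<in>{a..b}. compose {0..1} g f x = 2 powi k * x + c"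
    if ab: "0 \<le> a" "a < b" "b \<le> 1" "D \<inter> {a<..<b} = {}" for a b
  proof -
    have "B \<inter> {a<..<b} = {}"
      using ab by (auto simp: D_def)
    then obtain k :: int and c where kc: "\<And>x. x \<in> {a..b} \<Longrightarrow> f x = 2 powi k * x + c"
      using affB[OF ab(1-3)] by blast
    have "C \<inter> {f a<..<f b} = {}"
    proof (rule ccontr)
      assume "C \<inter> {f a<..<f b} \<noteq> {}"
      then obtain y where y: "y \<in> C" "f a < y" "y < f b"
        by auto
      have "y \<in> {0..1}"
        using y mem[of a] mem[of b] ab by auto
      then obtain x where x: "x \<in> {0..1}" "y = f x"
        using imf by blast
      have "a < x" "x < b"
        using y x ab strict_mono_on_less[OF mf, of a x] strict_mono_on_less[OF mf, of x b] by auto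
      then show False
        using ab x y by (auto simp: D_def)
    qed
    moreover have "f a < f b"
      using ab by (intro strict_mono_onD[OF mf]) auto
    ultimately obtain l :: int and d where ld: "\<And>x. x \<in> {f a..f b} \<Longrightarrow> g x = 2 powi l * x + d"
      using affC[of "f a" "f b"] mem[of a] mem[of b] ab by auto
    have "compose {0..1} g f x = 2 powi (l + k) * x + (2 powi l * c + d)" if x: "x \<in> {a..b}" for x
    proof -
      have "f x \<in> {f a..f b}"
        using x ab by (auto simp: kc)
      then have "g (f x) = 2 powi l * (2 powi k * x + c) + d"
        using ld[of "f x"] kc[OF x] by simp
      then show ?thesis
        using x ab by (simp add: compose_def power_int_add algebra_simps)
    qed
    then show ?thesis
      by blast
  qed
  have "dyadic_PL (compose {0..1} g f)"
    unfolding dyadic_PL_def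
  proof (intro exI[of _ D] conjI allI impI)
    fix a b :: real
    assume "0 \<le> a \<and> a < b \<and> b \<le> 1 \<and> D \<inter> {a<..<b} = {}"
    then show "\<exists>(k :: int) c. \<forall>x\<in>{a..b}. compose {0..1} g f x = 2 powi k * x + c"
      by (elim conjE) (rule affine)
  qed fact+
  moreover have "homeomorphism {0..1} {0..1} (compose {0..1} g f) (f' \<circ> g')"
    by (rule homeomorphism_cong[OF homeomorphism_compose[OF hf hg]]) (auto simp: compose_def)
  moreover have "strict_mono_on {0..1} (compose {0..1} g f)"
  proof (rule strict_mono_onI)
    fix r s :: real assume rs: "r \<in> {0..1}" "s \<in> {0..1}" "r < s"
    then have "f r < f s"
      by (intro strict_mono_onD[OF mf])
    then have "g (f r) < g (f s)"
      using mem rs by (intro strict_mono_onD[OF mg]) auto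
    then show "compose {0..1} g f r < compose {0..1} g f s"
      using rs by (simp add: compose_def)
  qed
  ultimately show ?thesis
    unfolding thompson_maps_def by auto
qed

lemma thompson_maps_inverse:
  assumes f: "f \<in> thompson_maps"
  shows "(\<lambda>x\<in>{0..1}. inv_into {0..1} f x) \<in> thompson_maps"
proof -
  obtain f' where hf: "homeomorphism {0..1} {0..1} f f'"
    using f unfolding thompson_maps_def by blast
  have mf: "strict_mono_on {0..1} f"
    using f unfolding thompson_maps_def by auto
  have imf: "f ` {0..1} = {0..1}" and inj: "inj_on f {0..1}"
    using f thompson_maps_subset_Bij by (auto simp: Bij_def bij_betw_def)
  obtain B where B: "finite B" "B \<subseteq> dyadic"
    and aff_all: "\<forall>a b. 0 \<le> a \<and> a < b \<and> b \<le> 1 \<and> B \<inter> {a<..<b} = {} \<longrightarrow>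
      (\<exists>(k :: int) c. \<forall>x\<in>{a..b}. f x = 2 powi k * x + c)"
    using f by (rule thompson_maps_affineE)
  note aff = aff_all[rule_format, OF conjI[OF _ conjI[OF _ conjI]]]
  define h where "h = (\<lambda>x\<in>{0..1}. inv_into {0..1} f x)"
  have h_mem: "h y \<in> {0..1}" and fh: "f (h y) = y" if "y \<in> {0..1}" for y
    using that imf inv_into_into[of y f "{0..1}"] f_inv_into_f[of y f "{0..1}"]
    by (auto simp: h_def)
  have h_less: "h y < h z" if "y \<in> {0..1}" "z \<in> {0..1}" "y < z" for y z
    using that strict_mono_on_less[OF mf, of "h y" "h z"] h_mem[OF that(1)] h_mem[OF that(2)]
    by (simp add: fh)
  define D where "D = f ` (B \<inter> {0..1})"
  have "finite D"
    using B by (simp add: D_def)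
  have "D \<subseteq> dyadic"
    using B thompson_maps_dyadic_iff[OF f] by (auto simp: D_def)
  have affine: "\<exists>(k :: int) c. \<forall>x\<in>{a..b}. h x = 2 powi k * x + c"
    if ab: "0 \<le> a" "a < b" "b \<le> 1" "D \<inter> {a<..<b} = {}" for a b
  proof -
    have mems: "h a \<in> {0..1}" "h b \<in> {0..1}" and fhab: "f (h a) = a" "f (h b) = b"
      using ab h_mem[of a] h_mem[of b] fh[of a] fh[of b] by auto
    have lt: "h a < h b"
      using ab by (intro h_less) auto
    have "B \<inter> {h a<..<h b} = {}"
    proof (rule ccontr)
      assume "B \<inter> {h a<..<h b} \<noteq> {}"
      then obtain x where x: "x \<in> B" "h a < x" "x < h b"
        by auto
      then have x01: "x \<in> {0..1}"
        using mems by auto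
      have "f (h a) < f x" "f x < f (h b)"
        using x x01 mems by (auto intro!: strict_mono_onD[OF mf])
      then have "f x \<in> D \<inter> {a<..<b}"
        using x x01 fhab by (auto simp: D_def)
      with ab(4) show False
        by blast
    qed
    then obtain k :: int and c where kc: "\<And>x. x \<in> {h a..h b} \<Longrightarrow> f x = 2 powi k * x + c"
      using aff[of "h a" "h b"] lt mems by auto
    have "h y = 2 powi (- k) * y + (- (2 powi (- k) * c))" if y: "y \<in> {a..b}" for y
    proof -
      have y01: "y \<in> {0..1}"
        using y ab by auto
      have "h a \<le> h y"
        using h_less[of a y] y y01 ab by (cases "a = y") auto
      moreover have "h y \<le> h b"
        using h_less[of y b] y y01 ab by (cases "b = y") auto
      ultimately have "y = 2 powi k * h y + c"
        using kc[of "h y"] fh[OF y01] by simp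
      then have "y - c = 2 powi k * h y"
        by simp
      then have "2 powi (- k) * (y - c) = 2 powi (- k) * 2 powi k * h y"
        by (simp only: mult.assoc)
      also have "\<dots> = h y"
        by (simp add: power_int_minus)
      finally show ?thesis
        by (simp add: algebra_simps)
    qed
    then show ?thesis
      by blast
  qed
  have "dyadic_PL h"
    unfolding dyadic_PL_def
  proof (intro exI[of _ D] conjI allI impI)
    fix a b :: real
    assume "0 \<le> a \<and> a < b \<and> b \<le> 1 \<and> D \<inter> {a<..<b} = {}"
    then show "\<exists>(k :: int) c. \<forall>x\<in>{a..b}. h x = 2 powi k * x + c"
      by (elim conjE) (rule affine)
  qed fact+
  moreover have "h y = f' y" if "y \<in> {0..1}" for y
  proof -
    have "f (f' y) = y" "f' y \<in> {0..1}"
      using hf that unfolding homeomorphism_def by auto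
    then show ?thesis
      using inj that h_mem[OF that] fh[OF that] by (metis inj_onD)
  qed
  then have "homeomorphism {0..1} {0..1} h f"
    by (intro homeomorphism_cong[OF homeomorphism_symD[OF hf]]) auto
  moreover have "strict_mono_on {0..1} h"
    by (intro strict_mono_onI h_less)
  ultimately show ?thesis
    unfolding thompson_maps_def h_def by auto
qed

lemma subgroup_thompson_maps: "subgroup thompson_maps (BijGroup {0..1})"
proof (rule group.subgroupI[OF group_BijGroup])
  show "thompson_maps \<subseteq> carrier (BijGroup {0..1})"
    using thompson_maps_subset_Bij by (simp add: BijGroup_def)
  show "thompson_maps \<noteq> {}"
    using thompson_maps_id by blast
next
  fix f assume f: "f \<in> thompson_maps"
  then have "f \<in> Bij {0..1}"
    using thompson_maps_subset_Bij by blast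
  then show "inv\<^bsub>BijGroup {0..1}\<^esub> f \<in> thompson_maps"
    using thompson_maps_inverse[OF f] by (simp add: inv_BijGroup)
next
  fix f g assume fg: "f \<in> thompson_maps" "g \<in> thompson_maps"
  then have "f \<in> Bij {0..1}" "g \<in> Bij {0..1}"
    using thompson_maps_subset_Bij by auto
  then show "f \<otimes>\<^bsub>BijGroup {0..1}\<^esub> g \<in> thompson_maps"
    using thompson_maps_compose[OF fg(2) fg(1)] by (simp add: BijGroup_def)
qed

theorem group_thompson_F: "group thompson_F"
  unfolding thompson_F_def
  by (rule subgroup.subgroup_is_group[OF subgroup_thompson_maps group_BijGroup])

end

theory Submission
  imports Defs
begin

text \<open>
  All words of length less than \<open>k\<close> are joined, separated by a letter with the unused index \<open>0\<close>, into one
  reduced word \<open>W\<close>. If the letter \<open>W ! q\<close> is to send the grid point \<open>q / 2 ^ M\<close> to its predecessor,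
  then reducedness of \<open>W\<close> says exactly that the partial maps so prescribed for each generator are
  well defined and strictly increasing. A strictly increasing map from a dyadic grid into a finer one
  extends to an element of \<open>F\<close>, because every positive integer \<open>n\<close> is a sum of \<open>C\<close> powers of two
  whenever \<open>n \<le> C\<close>. Every relation is then violated at the last grid point of its block.
\<close>

section \<open>Piecewise linear maps with prescribed power-of-two slopes\<close>

text \<open>Start from \<open>n\<close> summands equal to 1. Replacing one summand by two halves
  keeps the sum and adds one term; this is where negative exponents enter.\<close>

lemma sum_powers_of_two:
  assumes "0 < n" "n \<le> C"
  obtains d :: "nat \<Rightarrow> int" where "(\<Sum>q<C. 2 powi d q) = real n"
proof -
  have "\<exists>d :: nat \<Rightarrow> int. (\<Sum>q<C. 2 powi d q) = real n"
    using assms(2)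
  proof (induction C rule: dec_induct)
    case base
    show ?case
      by (rule exI[of _ "\<lambda>_. 0"]) simp
  next
    case (step C)
    then obtain d :: "nat \<Rightarrow> int" where d: "(\<Sum>q<C. 2 powi d q) = real n"
      by blast
    obtain C' where C': "C = Suc C'"
      using assms(1) step.hyps by (cases C) auto
    define d' where "d' = d(C' := d C' - 1, C := d C' - 1)"
    have "(\<Sum>q<C'. 2 powi d' q) = (\<Sum>q<C'. 2 powi d q :: real)"
      by (rule sum.cong) (auto simp: d'_def C')
    moreover have "2 powi (d C' - 1) = (2 powi d C' / 2 :: real)"
      by (simp add: power_int_diff)
    ultimately have "(\<Sum>q<Suc C. 2 powi d' q) = real n"
      using d by (simp add: C' d'_def)
    then show ?case
      by blast
  qed
  with that show ?thesis
    by blast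
qed

text \<open>The ramp profile of a cell: \<open>clamp01 (2 ^ l * x - real q)\<close> climbs from 0 to
  1 while \<open>x\<close> crosses the \<open>q\<close>-th cell and is constant elsewhere.\<close>

definition clamp01 :: "real \<Rightarrow> real" where
  "clamp01 x = max 0 (min 1 x)"

lemma clamp01_mono: "x \<le> y \<Longrightarrow> clamp01 x \<le> clamp01 y"
  by (auto simp: clamp01_def)

text \<open>The map of slope \<open>2 powi (d q + l - r)\<close> on the \<open>q\<close>-th of \<open>2 ^ l\<close> equal cells. In this form
  continuity and monotonicity need no gluing of cells.\<close>

definition cell_map :: "nat \<Rightarrow> (nat \<Rightarrow> int) \<Rightarrow> int \<Rightarrow> real \<Rightarrow> real" where
  "cell_map l d r x = (\<Sum>q<2 ^ l. 2 powi d q * clamp01 (2 ^ l * x - real q)) / 2 powi r"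

text \<open>On cell \<open>q\<close> the ramps of the cells to the left have already reached 1 and
  those to the right are still 0, so only one summand varies.\<close>

lemma cell_map_cell:
  assumes "q < 2 ^ l" "real q \<le> 2 ^ l * x" "2 ^ l * x \<le> real q + 1"
  shows "cell_map l d r x = ((\<Sum>p<q. 2 powi d p) + 2 powi d q * (2 ^ l * x - real q)) / 2 powi r"
proof -
  have "{..<2 ^ l} = {..<q} \<union> {q} \<union> {Suc q..<2 ^ l}"
    using assms(1) by auto
  then have "(\<Sum>p<2 ^ l. 2 powi d p * clamp01 (2 ^ l * x - real p)) =
      (\<Sum>p<q. 2 powi d p * clamp01 (2 ^ l * x - real p)) + 2 powi d q * clamp01 (2 ^ l * x - real q)
      + (\<Sum>p\<in>{Suc q..<2 ^ l}. 2 powi d p * clamp01 (2 ^ l * x - real p))"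
    by (subst (1) \<open>{..<2 ^ l} = _\<close>, subst sum.union_disjoint, simp, simp, force,
        subst sum.union_disjoint) auto
  also have "(\<Sum>p<q. 2 powi d p * clamp01 (2 ^ l * x - real p)) = (\<Sum>p<q. 2 powi d p)"
    using assms by (intro sum.cong) (auto simp: clamp01_def)
  also have "(\<Sum>p\<in>{Suc q..<2 ^ l}. 2 powi d p * clamp01 (2 ^ l * x - real p)) = 0"
    using assms by (intro sum.neutral) (auto simp: clamp01_def)
  also have "clamp01 (2 ^ l * x - real q) = 2 ^ l * x - real q"
    using assms by (auto simp: clamp01_def)
  finally show ?thesis
    by (simp add: cell_map_def)
qed

lemma unit_cellE:
  assumes "0 \<le> x" "x < 1"
  obtains q where "q < 2 ^ l" "real q \<le> 2 ^ l * x" "2 ^ l * x < real q + 1"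
proof
  define q where "q = nat \<lfloor>2 ^ l * x\<rfloor>"
  have q: "real q = of_int \<lfloor>2 ^ l * x\<rfloor>"
    using assms by (simp add: q_def)
  show "real q \<le> 2 ^ l * x" "2 ^ l * x < real q + 1"
    unfolding q by linarith+
  then have "real q < 2 ^ l"
    using assms(2) by (smt (verit) mult_less_cancel_left2 zero_less_power)
  then show "q < 2 ^ l"
    by (metis of_nat_less_iff of_nat_numeral of_nat_power)
qed

lemma cell_map_grid:
  assumes "j \<le> 2 ^ l"
  shows "cell_map l d r (real j / 2 ^ l) = (\<Sum>p<j. 2 powi d p) / 2 powi r"
proof (cases "j = 2 ^ l")
  case True
  \<comment> \<open>No cell begins at the right end, so \<open>cell_map_cell\<close> does not apply
    with \<open>q = j\<close>; instead all ramps are complete there.\<close>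
  have "clamp01 (2 ^ l - real p) = 1" if "p < 2 ^ l" for p
  proof -
    have "real (Suc p) \<le> real (2 ^ l)"
      using that by (subst of_nat_le_iff) simp
    then show ?thesis
      by (simp add: clamp01_def)
  qed
  then show ?thesis
    using True by (simp add: cell_map_def)
next
  case False
  then show ?thesis
    using assms by (subst cell_map_cell[of j]) auto
qed

text \<open>Every ramp is weakly increasing, and the ramp of the cell containing \<open>x\<close>
  increases strictly. The cell is half-open so that this ramp is still below 1 at
  \<open>x\<close>.\<close>

lemma cell_map_strict_mono: "strict_mono_on {0..1} (cell_map l d r)"
proof (rule strict_mono_onI)
  fix x y :: real
  assume xy: "x \<in> {0..1}" "y \<in> {0..1}" "x < y"
  obtain q where q: "q < 2 ^ l" "real q \<le> 2 ^ l * x" "2 ^ l * x < real q + 1"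
    using unit_cellE[of x l] xy by auto
  have lt: "2 ^ l * x < 2 ^ l * y"
    using xy by simp
  have "(\<Sum>p<2 ^ l. 2 powi d p * clamp01 (2 ^ l * x - real p))
      < (\<Sum>p<2 ^ l. 2 powi d p * clamp01 (2 ^ l * y - real p))"
  proof (rule sum_strict_mono_ex1)
    show "\<forall>p\<in>{..<2 ^ l}. 2 powi d p * clamp01 (2 ^ l * x - real p)
        \<le> 2 powi d p * clamp01 (2 ^ l * y - real p)"
      using lt by (auto intro!: mult_left_mono clamp01_mono)
    have "clamp01 u < clamp01 v" if "0 \<le> u" "u < 1" "u < v" for u v
      using that by (auto simp: clamp01_def)
    then have "clamp01 (2 ^ l * x - real q) < clamp01 (2 ^ l * y - real q)"
      using q lt by (simp del: mult_less_cancel_left_pos)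
    then show "\<exists>p\<in>{..<2 ^ l}. 2 powi d p * clamp01 (2 ^ l * x - real p)
        < 2 powi d p * clamp01 (2 ^ l * y - real p)"
      using q by (intro bexI[of _ q]) auto
  qed simp
  then show "cell_map l d r x < cell_map l d r y"
    by (simp add: cell_map_def divide_strict_right_mono)
qed

lemma cell_map_dyadic_PL: "dyadic_PL (restrict (cell_map l d r) {0..1})"
proof -
  define B where "B = (\<lambda>q. real q / 2 ^ l) ` {..2 ^ l}"
  have fin: "finite B"
    by (simp add: B_def)
  have sub: "B \<subseteq> dyadic"
    unfolding B_def dyadic_def by clarsimp (metis of_int_of_nat_eq)
  have affine: "\<exists>(k :: int) c. \<forall>x\<in>{a..b}. restrict (cell_map l d r) {0..1} x = 2 powi k * x + c"
    if ab: "0 \<le> a \<and> a < b \<and> b \<le> 1 \<and> B \<inter> {a<..<b} = {}" for a b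
  proof -
    obtain q where q: "q < 2 ^ l" "real q \<le> 2 ^ l * a" "2 ^ l * a < real q + 1"
      using unit_cellE[of a l] ab by auto
    \<comment> \<open>The right end of the cell of \<open>a\<close> is in \<open>B\<close>, hence
      not strictly between \<open>a\<close> and \<open>b\<close>; so the whole interval lies in one
      cell.\<close>
    have "real (Suc q) / 2 ^ l \<in> B"
      using q unfolding B_def by (intro imageI) simp
    moreover have "a < real (Suc q) / 2 ^ l"
      using q by (simp add: field_simps)
    ultimately have "b \<le> real (Suc q) / 2 ^ l"
      using ab by force
    then have b: "2 ^ l * b \<le> real q + 1"
      by (simp add: field_simps)
    have "restrict (cell_map l d r) {0..1} x =
        2 powi (d q + int l - r) * x + ((\<Sum>p<q. 2 powi d p) - 2 powi d q * real q) / 2 powi r"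
      if x: "x \<in> {a..b}" for x
    proof -
      have "2 ^ l * a \<le> 2 ^ l * x" "2 ^ l * x \<le> 2 ^ l * b"
        using x by simp_all
      then have "real q \<le> 2 ^ l * x" "2 ^ l * x \<le> real q + 1"
        using q b by linarith+
      then have "cell_map l d r x = ((\<Sum>p<q. 2 powi d p) + 2 powi d q * (2 ^ l * x - real q)) / 2 powi r"
        by (rule cell_map_cell[OF q(1)])
      then show ?thesis
        using x ab by (simp add: power_int_add power_int_diff field_simps)
    qed
    then show ?thesis
      by blast
  qed
  show ?thesis
    unfolding dyadic_PL_def using fin sub affine by (intro exI[of _ B] conjI allI impI)
qed

text \<open>The hypothesis says that the total rise is 1, so both endpoints are fixed. The
  intermediate value theorem gives surjectivity, and compactness gives a continuous inverse.\<close>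

lemma cell_map_thompson:
  assumes "(\<Sum>q<2 ^ l. 2 powi d q) = (2 powi r :: real)"
  shows "restrict (cell_map l d r) {0..1} \<in> thompson_maps"
proof -
  let ?f = "cell_map l d r"
  have f0: "?f 0 = 0" and f1: "?f 1 = 1"
    using cell_map_grid[of 0 l d r] cell_map_grid[of "2 ^ l" l d r] assms by auto
  note sm = cell_map_strict_mono[of l d r]
  have cont: "continuous_on {0..1} ?f"
    unfolding cell_map_def clamp01_def by (intro continuous_intros) auto
  have le: "?f x \<le> ?f y" if "x \<in> {0..1}" "y \<in> {0..1}" "x \<le> y" for x y
    using mono_onD[OF strict_mono_on_imp_mono_on[OF sm]] that by blast
  have "?f ` {0..1} = {0..1}"
  proof
    show "?f ` {0..1} \<subseteq> {0..1}"
      using le[of 0] le[of _ 1] f0 f1 by fastforce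
    show "{0..1} \<subseteq> ?f ` {0..1}"
    proof
      fix y :: real
      assume "y \<in> {0..1}"
      then obtain x where "0 \<le> x" "x \<le> 1" "?f x = y"
        using IVT'[of ?f 0 y 1] cont f0 f1 by auto
      then show "y \<in> ?f ` {0..1}"
        by force
    qed
  qed
  then obtain g where "homeomorphism {0..1} {0..1} ?f g"
    using homeomorphism_compact[OF compact_Icc cont] strict_mono_on_imp_inj_on[OF sm] by blast
  then have "homeomorphism {0..1} {0..1} (restrict ?f {0..1}) g"
    by (rule homeomorphism_cong) auto
  moreover have "strict_mono_on {0..1} (restrict ?f {0..1})"
    using sm by (simp add: strict_mono_on_def)
  ultimately show ?thesis
    using cell_map_dyadic_PL by (auto simp: thompson_maps_def)
qed

section \<open>Extending increasing grid maps to elements of F\<close>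

text \<open>Each grid cell is cut into \<open>C\<close> equal subcells, and its rise is distributed
  over them as \<open>C\<close> powers of two. The subcells have dyadic width, so all slopes are
  powers of two.\<close>

lemma thompson_extension:
  fixes h :: "nat \<Rightarrow> int"
  assumes h0: "h 0 = 0" and h1: "h (2 ^ M) = 2 ^ R"
    and inc: "\<And>j. j < 2 ^ M \<Longrightarrow> h j < h (Suc j)"
  obtains f where "f \<in> thompson_maps"
    "\<And>j. j \<le> 2 ^ M \<Longrightarrow> f (real j / 2 ^ M) = of_int (h j) / 2 ^ R"
proof -
  \<comment> \<open>The total rise \<open>2 ^ R\<close> bounds the rise of every single cell, so one
    number of subcells serves all cells; as a power of two it keeps the refined grid dyadic.\<close>
  define C :: nat where "C = 2 ^ R"
  have mono: "h i \<le> h j" if "i \<le> j" "j \<le> 2 ^ M" for i j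
    using that
  proof (induction j rule: dec_induct)
    case (step j)
    then show ?case
      using inc[of j] by simp
  qed simp
  have "\<exists>d :: nat \<Rightarrow> int. (\<Sum>q<C. 2 powi d q) = real_of_int (h (Suc j) - h j)" if j: "j < 2 ^ M" for j
  proof -
    have "h (Suc j) - h j \<le> 2 ^ R"
      using mono[of 0 j] mono[of "Suc j" "2 ^ M"] j h0 h1 by simp
    then have "nat (h (Suc j) - h j) \<le> C"
      by (simp add: C_def nat_le_iff)
    then show ?thesis
      using sum_powers_of_two[of "nat (h (Suc j) - h j)" C] inc[OF j] by auto
  qed
  then obtain D :: "nat \<Rightarrow> nat \<Rightarrow> int"
    where D: "\<And>j. j < 2 ^ M \<Longrightarrow> (\<Sum>q<C. 2 powi D j q) = real_of_int (h (Suc j) - h j)"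
    by metis
  \<comment> \<open>Subcell \<open>q\<close> of the refined grid is subcell \<open>q mod C\<close>
    of the coarse cell \<open>q div C\<close>.\<close>
  define d where "d q = D (q div C) (q mod C)" for q
  have C: "C > 0"
    by (simp add: C_def)
  have block: "(\<Sum>q\<in>{m * C..<m * C + C}. 2 powi d q) = (\<Sum>q<C. 2 powi D m q :: real)" for m
    unfolding sum.atLeastLessThan_shift_0[of _ "m * C"] lessThan_atLeast0
    by (rule sum.cong) (auto simp: d_def)
  have sums: "(\<Sum>q<j * C. 2 powi d q) = real_of_int (h j)" if j: "j \<le> 2 ^ M" for j
  proof -
    have "(\<Sum>q<j * C. 2 powi d q :: real) = (\<Sum>m<j. \<Sum>q<C. 2 powi D m q)"
      by (simp add: block flip: sum.nat_group)
    also have "\<dots> = (\<Sum>m<j. of_int (h (Suc m)) - of_int (h m))"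
      using j by (intro sum.cong) (auto simp: D)
    also have "\<dots> = of_int (h j)"
      by (subst sum_lessThan_telescope) (simp add: h0)
    finally show ?thesis .
  qed
  have MC: "2 ^ (M + R) = 2 ^ M * C"
    by (simp add: C_def power_add)
  let ?f = "cell_map (M + R) d (int R)"
  have "restrict ?f {0..1} \<in> thompson_maps"
    using sums[of "2 ^ M"] by (intro cell_map_thompson) (simp add: MC h1)
  moreover have "restrict ?f {0..1} (real j / 2 ^ M) = of_int (h j) / 2 ^ R" if j: "j \<le> 2 ^ M" for j
  proof -
    have "real j \<le> real (2 ^ M)"
      using j by (subst of_nat_le_iff)
    then have "real j / 2 ^ M \<in> {0..1}"
      by simp
    moreover have "real j / 2 ^ M = real (j * C) / 2 ^ (M + R)"
      by (simp add: C_def power_add)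
    moreover have "j * C \<le> 2 ^ (M + R)"
      using j by (simp add: MC)
    ultimately show ?thesis
      using cell_map_grid[of "j * C" "M + R" d "int R"] sums[OF j] by simp
  qed
  ultimately show ?thesis
    by (rule that)
qed

text \<open>Index \<open>Suc q\<close> stands for the edge between grid points \<open>q\<close> and
  \<open>Suc q\<close>, to be traversed upwards or downwards. The exclusions forbid swapping the
  ends of an edge, sending two points to one, and giving one point two images. The bounds keep
  prescribed points and their images away from 0 and 1.\<close>

lemma thompson_shifts:
  fixes up dn :: "nat \<Rightarrow> bool"
  assumes excl: "\<And>q. \<not> (up q \<and> dn q)" "\<And>q. \<not> (up q \<and> dn (Suc q))" "\<And>q. \<not> (dn q \<and> up (Suc q))"
    and low: "\<And>q. up q \<or> dn q \<Longrightarrow> 1 < q" and high: "\<And>q. up q \<or> dn q \<Longrightarrow> q < 2 ^ M"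
  obtains f where "f \<in> thompson_maps"
    "\<And>q. up (Suc q) \<Longrightarrow> f (real q / 2 ^ M) = real (Suc q) / 2 ^ M"
    "\<And>q. dn (Suc q) \<Longrightarrow> f (real (Suc q) / 2 ^ M) = real q / 2 ^ M"
proof -
  \<comment> \<open>The values are in units of a quarter of the grid width. The vertices at which nothing is
    prescribed are moved by a quarter where they must make room for a neighbour.\<close>
  define h :: "nat \<Rightarrow> int" where "h j =
    4 * int j + (if dn j then -4 else if up (Suc j) then 4 else if up j then 1
      else if dn (Suc j) then -1 else 0)" for j
  have "h 0 = 0"
    using low[of 0] low[of "Suc 0"] by (auto simp: h_def)
  moreover have "h (2 ^ M) = 2 ^ (M + 2)"
    using high[of "2 ^ M"] high[of "Suc (2 ^ M)"] by (auto simp: h_def)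
  moreover have "h j < h (Suc j)" for j
    using excl[of j] excl[of "Suc j"] by (auto simp: h_def)
  ultimately obtain f where f: "f \<in> thompson_maps"
    "\<And>j. j \<le> 2 ^ M \<Longrightarrow> f (real j / 2 ^ M) = of_int (h j) / 2 ^ (M + 2)"
    using thompson_extension[of h M "M + 2"] by blast
  show ?thesis
  proof (rule that[OF f(1)])
    fix q
    assume q: "up (Suc q)"
    then have "h q = 4 * int (Suc q)"
      using excl(3)[of q] by (auto simp: h_def)
    then show "f (real q / 2 ^ M) = real (Suc q) / 2 ^ M"
      using f(2)[of q] high[of "Suc q"] q by (simp add: power_add field_simps)
  next
    fix q
    assume q: "dn (Suc q)"
    then have "h (Suc q) = 4 * int q"
      by (auto simp: h_def)
    then show "f (real (Suc q) / 2 ^ M) = real q / 2 ^ M"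
      using f(2)[of "Suc q"] high[of "Suc q"] q by (simp add: power_add field_simps)
  qed
qed

section \<open>Words acting on grid points\<close>

lemma thompson_one_apply: "x \<in> {0..1} \<Longrightarrow> \<one>\<^bsub>thompson_F\<^esub> x = x"
  by (simp add: thompson_F_def BijGroup_def)

lemma thompson_mult_apply:
  "f \<in> carrier thompson_F \<Longrightarrow> g \<in> carrier thompson_F \<Longrightarrow> x \<in> {0..1} \<Longrightarrow>
    (f \<otimes>\<^bsub>thompson_F\<^esub> g) x = f (g x)"
  using thompson_maps_subset_Bij by (auto simp: thompson_F_def BijGroup_def compose_def)

lemma thompson_inv_apply:
  assumes f: "f \<in> carrier thompson_F" and x: "x \<in> {0..1}"
  shows "(inv\<^bsub>thompson_F\<^esub> f) (f x) = x"
proof -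
  interpret group thompson_F
    by (rule group_thompson_F)
  have "(inv\<^bsub>thompson_F\<^esub> f) (f x) = (inv\<^bsub>thompson_F\<^esub> f \<otimes>\<^bsub>thompson_F\<^esub> f) x"
    by (rule thompson_mult_apply[OF inv_closed[OF f] f x, symmetric])
  then show ?thesis
    by (simp add: l_inv[OF f] thompson_one_apply[OF x])
qed

lemma thompson_word_value_mem:
  assumes "\<And>i s. (i, s) \<in> set w \<Longrightarrow> a i \<in> carrier thompson_F"
  shows "word_value thompson_F a w \<in> carrier thompson_F"
proof -
  interpret group thompson_F
    by (rule group_thompson_F)
  show ?thesis
    using assms by (induction w) (force simp: word_value_def letter_value_def)+
qed

text \<open>The rightmost letter acts first, so the point starts at the last position of the block
  and moves one grid point left per letter. The two leading letters of index 0 reserve positions 0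
  and 1; nothing is demanded of generator 0.\<close>

lemma thompson_word_walk:
  assumes W: "reduced_word W" "take 2 W = [(0, True), (0, True)]"
  obtains a :: "nat \<Rightarrow> real \<Rightarrow> real" and M where
    "\<And>i. i \<noteq> 0 \<Longrightarrow> a i \<in> carrier thompson_F"
    "\<And>xs w ys. W = xs @ w @ ys \<Longrightarrow> xs \<noteq> [] \<Longrightarrow> 0 \<notin> fst ` set w \<Longrightarrow>
      word_value thompson_F a w (real (length xs + length w - 1) / 2 ^ M) = real (length xs - 1) / 2 ^ M"
    "length W < 2 ^ M"
proof -
  define M where "M = length W"
  have M: "length W < 2 ^ M"
    by (simp add: M_def)
  interpret group thompson_F
    by (rule group_thompson_F)
  have red: "\<not> (W ! q = (i, s) \<and> W ! Suc q = (i, \<not> s))" if "Suc q < length W" for q i s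
    using W(1) that unfolding reduced_word_def successively_conv_nth by (auto dest!: spec[of _ q])
  have start: "W ! q = (0, True)" if "q < 2" for q
  proof -
    have "W ! q = take 2 W ! q"
      using that by simp
    then show ?thesis
      using that unfolding W(2) by (auto simp: less_2_cases_iff)
  qed
  \<comment> \<open>A letter \<open>(i, True)\<close> makes \<open>a i\<close> move down one step.
    For \<open>(i, False)\<close> the inverse must move down, so \<open>a i\<close> itself moves
    up.\<close>
  have "\<exists>f. f \<in> thompson_maps \<and>
      (\<forall>q. Suc q < length W \<and> W ! Suc q = (i, False) \<longrightarrow> f (real q / 2 ^ M) = real (Suc q) / 2 ^ M) \<and>
      (\<forall>q. Suc q < length W \<and> W ! Suc q = (i, True) \<longrightarrow> f (real (Suc q) / 2 ^ M) = real q / 2 ^ M)"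
    if i: "i \<noteq> 0" for i
  proof (rule thompson_shifts[of "\<lambda>q. q < length W \<and> W ! q = (i, False)"
        "\<lambda>q. q < length W \<and> W ! q = (i, True)" M])
    fix q
    show "\<not> ((q < length W \<and> W ! q = (i, False)) \<and> Suc q < length W \<and> W ! Suc q = (i, True))"
      "\<not> ((q < length W \<and> W ! q = (i, True)) \<and> Suc q < length W \<and> W ! Suc q = (i, False))"
      using red[of q i True] red[of q i False] by auto
    assume q: "q < length W \<and> W ! q = (i, False) \<or> q < length W \<and> W ! q = (i, True)"
    show "q < 2 ^ M"
      using q M by linarith
    show "1 < q"
    proof (rule ccontr)
      assume "\<not> 1 < q"
      then show False
        using start[of q] q i by auto
    qed
  next
    fix f
    assume "f \<in> thompson_maps"
      "\<And>q. Suc q < length W \<and> W ! Suc q = (i, False) \<Longrightarrow> f (real q / 2 ^ M) = real (Suc q) / 2 ^ M"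
      "\<And>q. Suc q < length W \<and> W ! Suc q = (i, True) \<Longrightarrow> f (real (Suc q) / 2 ^ M) = real q / 2 ^ M"
    then show ?thesis
      by blast
  qed auto
  then obtain a where mem: "\<And>i. i \<noteq> 0 \<Longrightarrow> a i \<in> thompson_maps"
    and up: "\<And>i q. i \<noteq> 0 \<Longrightarrow> Suc q < length W \<Longrightarrow> W ! Suc q = (i, False)
      \<Longrightarrow> a i (real q / 2 ^ M) = real (Suc q) / 2 ^ M"
    and dn: "\<And>i q. i \<noteq> 0 \<Longrightarrow> Suc q < length W \<Longrightarrow> W ! Suc q = (i, True)
      \<Longrightarrow> a i (real (Suc q) / 2 ^ M) = real q / 2 ^ M"
    by metis
  have car: "a i \<in> carrier thompson_F" if "i \<noteq> 0" for i
    using mem[OF that] by (simp add: thompson_F_def)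
  have grid: "real q / 2 ^ M \<in> {0..1}" if "q \<le> length W" for q
  proof -
    have "real q \<le> real (2 ^ M)"
      using that M by (subst of_nat_le_iff) linarith
    then show ?thesis
      by simp
  qed
  have "word_value thompson_F a w (real (length xs + length w - 1) / 2 ^ M) = real (length xs - 1) / 2 ^ M"
    if "W = xs @ w @ ys" "xs \<noteq> []" "0 \<notin> fst ` set w" for xs w ys
    using that
  proof (induction w arbitrary: xs)
    case Nil
    then show ?case
      using grid[of "length xs - 1"] by (simp add: word_value_def thompson_one_apply)
  next
    case (Cons l w)
    obtain i s where l: "l = (i, s)"
      by (cases l)
    obtain q where q: "length xs = Suc q"
      using Cons.prems(2) by (cases xs) auto
    have i: "i \<noteq> 0"
      using Cons.prems(3) by (auto simp: l)
    have len: "Suc q < length W" and nth: "W ! Suc q = (i, s)"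
      using Cons.prems(1) q l by (auto simp: nth_append)
    have w: "word_value thompson_F a w \<in> carrier thompson_F"
      using Cons.prems(3) by (intro thompson_word_value_mem car) force
    have lc: "letter_value thompson_F a l \<in> carrier thompson_F"
      using car[OF i] by (simp add: letter_value_def l)
    \<comment> \<open>With \<open>l\<close> moved to the prefix, the starting point is unchanged and
      the tail stops at \<open>Suc q\<close>; the letter \<open>l\<close>, acting last, makes the
      remaining step to \<open>q\<close>.\<close>
    have "word_value thompson_F a w (real (length (xs @ [l]) + length w - 1) / 2 ^ M)
        = real (length (xs @ [l]) - 1) / 2 ^ M"
      using Cons.prems by (intro Cons.IH) auto
    then have *: "word_value thompson_F a w (real (length xs + length (l # w) - 1) / 2 ^ M)
        = real (Suc q) / 2 ^ M"
      by (simp add: q)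
    have "word_value thompson_F a (l # w) (real (length xs + length (l # w) - 1) / 2 ^ M)
        = letter_value thompson_F a l (real (Suc q) / 2 ^ M)"
    proof -
      have "real (length xs + length (l # w) - 1) / 2 ^ M \<in> {0..1}"
        using Cons.prems(1) by (intro grid) simp
      then have "(letter_value thompson_F a l \<otimes>\<^bsub>thompson_F\<^esub> word_value thompson_F a w)
            (real (length xs + length (l # w) - 1) / 2 ^ M)
          = letter_value thompson_F a l (real (Suc q) / 2 ^ M)"
        by (simp only: thompson_mult_apply[OF lc w] *)
      then show ?thesis
        by (simp add: word_value_def)
    qed
    also have "\<dots> = real q / 2 ^ M"
    proof (cases s)
      case True
      then show ?thesis
        using dn[OF i len] nth by (simp add: letter_value_def l)
    next
      case False
      then have "a i (real q / 2 ^ M) = real (Suc q) / 2 ^ M"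
        using up[OF i len] nth by simp
      then show ?thesis
        using thompson_inv_apply[OF car[OF i] grid[of q]] len False
        by (simp add: letter_value_def l)
    qed
    finally show ?case
      by (simp add: q)
  qed
  from car this M show ?thesis
    by (rule that)
qed

section \<open>Joining all short words into one\<close>

text \<open>Index 0 occurs in no block, so nothing cancels at a seam. Around an empty block two
  separators meet, but they have the same sign.\<close>

lemma reduced_word_separated:
  assumes "\<And>w. w \<in> set ws \<Longrightarrow> reduced_word w \<and> 0 \<notin> fst ` set w"
  shows "reduced_word ((0, True) # concat (map (\<lambda>w. w @ [(0, True)]) ws))"
  using assms
proof (induction ws)
  case Nil
  then show ?case
    by (simp add: reduced_word_def)
next
  case (Cons w ws)
  have rec: "reduced_word ((0, True) # concat (map (\<lambda>w. w @ [(0, True)]) ws))"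
    by (intro Cons.IH) (simp add: Cons.prems)
  have w: "reduced_word w" "0 \<notin> fst ` set w"
    using Cons.prems by auto
  have mem: "fst l \<noteq> 0" if "l \<in> set w" for l
    using w(2) that by (metis image_eqI)
  show ?case
  proof (cases "w = []")
    case True
    then show ?thesis
      using rec by (simp add: reduced_word_def)
  next
    case False
    then have "fst (hd w) \<noteq> 0" "fst (last w) \<noteq> 0"
      using mem by auto
    then show ?thesis
      using rec w(1) False
      by (auto simp: reduced_word_def successively_append_iff successively_Cons hd_append split: prod.splits)
  qed
qed

theorem theorem2:
  fixes n k :: nat
  shows "\<exists>a :: nat \<Rightarrow> real \<Rightarrow> real.
           (\<forall>i\<in>{1..n}. a i \<in> carrier thompson_F) \<and>
           (\<forall>w. relation_in n w \<and> length w < k \<longrightarrow> \<not> satisfies thompson_F a w)"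
proof -
  have "finite {w. relation_in n w \<and> length w < k}"
  proof (rule finite_subset)
    show "{w. relation_in n w \<and> length w < k}
        \<subseteq> {w. set w \<subseteq> {1..n} \<times> (UNIV :: bool set) \<and> length w \<le> k}"
      unfolding relation_in_def by force
  qed (simp add: finite_lists_length_le)
  then obtain ws where ws: "set ws = {w. relation_in n w \<and> length w < k}"
    using finite_list by blast
  have red: "reduced_word w \<and> 0 \<notin> fst ` set w" if "w \<in> set ws" for w
    using that by (auto simp: ws relation_in_def)
  \<comment> \<open>The empty word in front supplies the second leading separator that
    \<open>thompson_word_walk\<close> requires.\<close>
  define W where "W = (0, True) # concat (map (\<lambda>w. w @ [(0, True)]) ([] # ws))"
  have "reduced_word W"
    unfolding W_def using red by (intro reduced_word_separated) (auto simp: reduced_word_def)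
  moreover have "take 2 W = [(0, True), (0, True)]"
    by (simp add: W_def)
  ultimately obtain a :: "nat \<Rightarrow> real \<Rightarrow> real" and M where car: "\<And>i. i \<noteq> 0 \<Longrightarrow> a i \<in> carrier thompson_F"
    and walk: "\<And>xs w ys. W = xs @ w @ ys \<Longrightarrow> xs \<noteq> [] \<Longrightarrow> 0 \<notin> fst ` set w \<Longrightarrow>
      word_value thompson_F a w (real (length xs + length w - 1) / 2 ^ M) = real (length xs - 1) / 2 ^ M"
    and len: "length W < 2 ^ M"
    using thompson_word_walk[of W] by blast
  have "\<not> satisfies thompson_F a w" if w: "relation_in n w" "length w < k" for w
  proof
    assume sat: "satisfies thompson_F a w"
    have "w \<in> set ws"
      using w by (simp add: ws)
    then obtain us vs where "ws = us @ w # vs"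
      by (meson split_list)
    then obtain xs ys where W: "W = xs @ w @ ys" "xs \<noteq> []"
      by (simp add: W_def) (metis append_Cons append.assoc list.distinct(1))
    \<comment> \<open>The last position of the block of \<open>w\<close>. The walk takes it to
      \<open>length xs - 1\<close>, which is smaller because \<open>w\<close> is nonempty, whereas a
      satisfied relation would fix it.\<close>
    define q where "q = length xs + length w - 1"
    have "length xs - 1 < q"
      using w(1) W(2) by (cases xs; cases w) (auto simp: q_def relation_in_def)
    moreover have "q \<le> 2 ^ M"
      using W(1) len by (simp add: q_def)
    then have "real q \<le> real (2 ^ M)"
      by (subst of_nat_le_iff)
    then have "word_value thompson_F a w (real q / 2 ^ M) = real q / 2 ^ M"
      using sat by (simp add: satisfies_def thompson_one_apply)
    ultimately show False
      using walk[OF W] red[OF \<open>w \<in> set ws\<close>] by (simp add: q_def)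
  qed
  then show ?thesis
    using car by (intro exI[of _ a]) auto
qed

end
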